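(* Let $Y$ be a nonempty finite set, let $E=\{v_1,\dots,v_{|Y|}\}$ be the set of standard basis vectors of $\mathbb{R}^{|Y|}$, and let $U=\mathrm{conv}(E)=\{u\in[0,1]^{|Y|}\mid \boldsymbol{1}^Tu=1\}$. For any sequence $\{u_k\}_{k\ge1}$ of points from $U$ there exists a sequence $\{e_k\}_{k\ge1}$ of points from $E$ such that $\left\|\sum_{i=1}^k(u_i-e_i)\right\|_2$ is uniformly bounded for all $k\in\{1,2,\dots\}$, i.e. bounded by a constant not depending on $k$.
   Context: $\boldsymbol{1}$ denotes the all-ones vector. The set $Y$ (a finite collection of points from $\mathbb{R}^n$, the discrete actions) enters only through its cardinality $|Y|$. *)

theory Defs
  imports "HOL-Analysis.Analysis"
begin

text \<open>The set \<open>E\<close> is rendered as the library's \<open>Basis :: (real ^ 'n) set\<close> and \<open>U\<close> as its convex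
  hull. The two facts below record that these are the standard unit vectors and the
  coordinate description of the simplex.\<close>

lemma Basis_eq_range_axis: "(Basis :: (real ^ 'n) set) = range (\<lambda>i. axis i 1)"
  by (auto simp: Basis_vec_def)

lemma convex_hull_Basis_eq:
  "convex hull (Basis :: (real ^ 'n) set) = {u. (\<forall>i. u $ i \<in> {0..1}) \<and> 1 \<bullet> u = 1}"
proof -
  have "convex hull (Basis :: (real ^ 'n) set) =
      {u. (\<forall>i. 0 \<le> u $ i) \<and> (\<Sum>i\<in>UNIV. u $ i) = 1}"
  proof (intro equalityI hull_minimal subsetI)
    fix u :: "real ^ 'n"
    assume "u \<in> Basis"
    then show "u \<in> {u. (\<forall>i. 0 \<le> u $ i) \<and> (\<Sum>i\<in>UNIV. u $ i) = 1}"
      by (auto simp: Basis_eq_range_axis axis_def)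
  next
    show "convex {u :: real ^ 'n. (\<forall>i. 0 \<le> u $ i) \<and> (\<Sum>i\<in>UNIV. u $ i) = 1}"
      by (auto simp: convex_def sum.distrib simp flip: sum_distrib_left)
  next
    fix u :: "real ^ 'n"
    assume u: "u \<in> {u. (\<forall>i. 0 \<le> u $ i) \<and> (\<Sum>i\<in>UNIV. u $ i) = 1}"
    have "(\<Sum>i\<in>UNIV. u $ i *\<^sub>R axis i (1::real)) \<in> convex hull (Basis :: (real ^ 'n) set)"
      using u by (intro convex_sum) (auto simp: Basis_eq_range_axis intro!: hull_inc)
    moreover have "(\<Sum>i\<in>UNIV. u $ i *\<^sub>R axis i (1::real)) = u"
      using basis_expansion[of u] by (simp add: scalar_mult_eq_scaleR)
    ultimately show "u \<in> convex hull (Basis :: (real ^ 'n) set)" by simp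
  qed
  also have "\<dots> = {u. (\<forall>i. u $ i \<in> {0..1}) \<and> 1 \<bullet> u = 1}"
  proof -
    have "u $ i \<le> 1" if "\<forall>i. 0 \<le> u $ i" "(\<Sum>i\<in>UNIV. u $ i) = 1" for u :: "real ^ 'n" and i
      using member_le_sum[of i UNIV "\<lambda>i. u $ i"] that by auto
    then show ?thesis by (auto simp: inner_vec_def)
  qed
  finally show ?thesis .
qed

end

theory Submission imports Defs begin

text \<open>The discrepancy \<open>s = (\<Sum>i\<le>k. u i - e i)\<close> always has coordinate sum \<open>0\<close>, so \<open>s + u (k + 1)\<close>
  has coordinate sum \<open>1\<close> and hence a positive coordinate. Subtracting the basis vector of any
  such coordinate keeps every coordinate at least \<open>-1\<close>. Vectors with coordinate sum \<open>0\<close> and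
  coordinates at least \<open>-1\<close> form a bounded set.\<close>

definition balanced :: "real ^ 'n \<Rightarrow> bool"
  where "balanced s \<longleftrightarrow> (\<forall>i. - 1 \<le> s $ i) \<and> (\<Sum>i\<in>UNIV. s $ i) = 0"

lemma balanced_zero: "balanced 0"
  by (simp add: balanced_def)

text \<open>For \<open>x \<ge> -1\<close> one has \<open>\<bar>x\<bar> \<le> x + 2\<close>; summed
  over the coordinates, the \<open>x\<close> parts cancel and only the constants 2 remain.\<close>

lemma balanced_norm_le:
  fixes s :: "real ^ 'n"
  assumes "balanced s"
  shows "norm s \<le> 2 * CARD('n)"
proof -
  have "norm s \<le> (\<Sum>i\<in>UNIV. \<bar>s $ i\<bar>)"
    by (rule norm_le_l1_cart)
  also have "\<dots> \<le> (\<Sum>i\<in>UNIV. s $ i + 2)"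
  proof (rule sum_mono)
    fix i
    have "- 1 \<le> s $ i" using assms by (simp add: balanced_def)
    then show "\<bar>s $ i\<bar> \<le> s $ i + 2" by linarith
  qed
  also have "\<dots> = 2 * CARD('n)"
    using assms by (simp add: balanced_def sum.distrib)
  finally show ?thesis .
qed

lemma balanced_step:
  fixes s v :: "real ^ 'n"
  assumes s: "balanced s" and v: "v \<in> convex hull Basis"
  obtains b where "b \<in> Basis" "balanced (s + v - b)"
proof -
  have nonneg: "0 \<le> v $ i" for i
    using v by (simp add: convex_hull_Basis_eq)
  have "(\<Sum>i\<in>UNIV. v $ i) = 1"
    using v by (simp add: convex_hull_Basis_eq inner_vec_def)
  with s have sum: "(\<Sum>i\<in>UNIV. (s + v) $ i) = 1"
    by (simp add: balanced_def sum.distrib)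
  obtain j where j: "0 < (s + v) $ j"
    using sum sum_nonpos[of UNIV "\<lambda>i. (s + v) $ i"] by (metis not_le not_one_le_zero)
  \<comment> \<open>At \<open>j\<close> a positive value drops by 1; elsewhere nothing is subtracted
    and \<open>v\<close> only adds to \<open>s\<close>.\<close>
  have "- 1 \<le> (s + v - axis j 1) $ i" for i
  proof (cases "i = j")
    case True
    then show ?thesis using j by simp
  next
    case False
    have "- 1 \<le> s $ i" using s by (simp add: balanced_def)
    with False nonneg[of i] show ?thesis by (simp add: axis_def)
  qed
  moreover have "(\<Sum>i\<in>UNIV. (s + v - axis j 1) $ i) = 0"
    using sum by (simp add: sum_subtractf axis_def)
  ultimately have "balanced (s + v - axis j 1)"
    by (simp add: balanced_def)
  then show thesis
    by (rule that[rotated]) (simp add: Basis_eq_range_axis)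
qed

theorem theorem2:
  fixes Y :: "'a set" and u :: "nat \<Rightarrow> real ^ 'n"
  assumes "finite Y" and "Y \<noteq> {}" and "CARD('n) = card Y"
    and "\<And>k. k \<ge> 1 \<Longrightarrow> u k \<in> convex hull (Basis :: (real ^ 'n) set)"
  shows "\<exists>e :: nat \<Rightarrow> real ^ 'n. (\<forall>k\<ge>1. e k \<in> Basis) \<and>
    (\<exists>C :: real. \<forall>k\<ge>1. norm (\<Sum>i=1..k. u i - e i) \<le> C)"
proof -
  \<comment> \<open>The choice runs over the discrepancies \<open>s k\<close> instead of the points
    \<open>e k\<close>, because the invariant speaks of them. The clause for \<open>k = 0\<close>
    pins the start to the empty sum.\<close>
  have "\<exists>s. \<forall>k. (balanced (s k) \<and> (k = 0 \<longrightarrow> s k = 0)) \<and> s k + u (Suc k) - s (Suc k) \<in> Basis"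
  proof (rule dependent_nat_choice)
    show "\<exists>s :: real ^ 'n. balanced s \<and> ((0::nat) = 0 \<longrightarrow> s = 0)"
      using balanced_zero by blast
  next
    fix s :: "real ^ 'n" and k :: nat
    assume "balanced s \<and> (k = 0 \<longrightarrow> s = 0)"
    then obtain b where "b \<in> Basis" "balanced (s + u (Suc k) - b)"
      using balanced_step[of s "u (Suc k)"] assms(4)[of "Suc k"] by auto
    then show "\<exists>t. (balanced t \<and> (Suc k = 0 \<longrightarrow> t = 0)) \<and> s + u (Suc k) - t \<in> Basis"
      by (intro exI[of _ "s + u (Suc k) - b"]) simp
  qed
  then obtain s where s: "balanced (s k)" "s 0 = 0" "s k + u (Suc k) - s (Suc k) \<in> Basis" for k
    by blast
  \<comment> \<open>Solving \<open>s k = s (k - 1) + u k - e k\<close> for \<open>e k\<close>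
    recovers the points, so \<open>u i - e i = s i - s (i - 1)\<close> for \<open>i \<ge> 1\<close>
    and the sum telescopes from \<open>s 0 = 0\<close>.\<close>
  define e where "e k = s (k - 1) + u k - s k" for k
  have "(\<Sum>i=1..k. u i - e i) = s k" for k
    by (induction k) (simp_all add: s(2) e_def)
  moreover have "e k \<in> Basis" if "k \<ge> 1" for k
    using s(3)[of "k - 1"] that by (simp add: e_def)
  ultimately show ?thesis
    using balanced_norm_le[OF s(1)] by (intro exI[of _ e]) auto
qed

end
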